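(* Let partial order relations be defined by $r_{\mathrm y}=(-,-)^\top$, $r_{\mathrm x}=(+,+,+)^\top$, $r_{\mathrm u}=+$, $r_{\mathrm p}=(-,-,-,+,-,+,-,+,+,-,-,+,-,+,-,+)^\top$ and $r_\varphi=(-,+,-)^\top$. Consider parameter vectors $p^{\mathrm a},p^{\mathrm b}\in\mathbb D_{\mathrm p}$ satisfying $c_{11}^{\mathrm a}=c_{11}^{\mathrm b}$ and $c_{12}^{\mathrm a}=c_{12}^{\mathrm b}$, initial conditions $x_0^{\mathrm a},x_0^{\mathrm b}\in\mathbb D_{\mathrm x}$, and input signals $u^{\mathrm a}(t),u^{\mathrm b}(t)\in\mathbb D_{\mathrm u}$ for all $t\ge0$, that are ordered according to $$p^{\mathrm a}\preceq_{r_{\mathrm p}}p^{\mathrm b},\qquad x_0^{\mathrm a}\preceq_{r_{\mathrm x}}x_0^{\mathrm b},\qquad u^{\mathrm a}(t)\preceq_{r_{\mathrm u}}u^{\mathrm b}(t)\ \text{ for all } t\ge0 .$$ Then the corresponding output trajectories $y^{\mathrm a}(t),y^{\mathrm b}(t)$ and static characteristics $\varphi(p^{\mathrm a},\cdot),\varphi(p^{\mathrm b},\cdot)$ of the class of systems $\Sigma(p)$ are monotone in the following sense: (1) $y^{\mathrm a}(t)\preceq_{r_{\mathrm y}}y^{\mathrm b}(t)$ for all $t\ge0$; (2) $\varphi(p^{\mathrm a},y_\lambda^{\mathrm{eq}})\preceq_{r_\varphi}\varphi(p^{\mathrm b},y_\lambda^{\mathrm{eq}})$ for all $y_\lambda^{\mathrm{eq}}\in\mathbb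 D_{\mathrm y}$.
   Context: Order relations. For a sign vector $r$ with entries in $\{+,0,-\}$ (read as $+1,0,-1$) and vectors $v^{\mathrm a},v^{\mathrm b}$ of the same length, $v^{\mathrm a}\preceq_r v^{\mathrm b}$ means $\mathrm{diag}(r)(v^{\mathrm a}-v^{\mathrm b})\le 0$ entrywise (entry $+$: $v_i^{\mathrm a}\le v_i^{\mathrm b}$; entry $-$: $v_i^{\mathrm a}\ge v_i^{\mathrm b}$; entry $0$: no constraint). Parameters. $p=(a_{11},a_{112},a_{113},a_{12},a_{123},a_{212},a_{22},a_{313},a_{323},a_{33c},a_{33m},b,c_{11},c_{12},c_{20},c_{21})^\top$, in this order. Superscripts a, b on a parameter denote the corresponding entry of $p^{\mathrm a}$, $p^{\mathrm b}$. Model $\Sigma(p)$. State $x=(x_{rg},x_{ta},x_{su})^\top$, scalar input $u$, output $y=(y_\lambda,y_{sb})^\top$, with $\dot x(t)=f(p,x(t),u(t))$, $x(0)=x_0$, $y(t)=g(p,x(t))$, where $$f_1=x_{rg}\big[-a_{11}+a_{112}(x_{ta}-1)+a_{113}(x_{su}-1)\big]+a_{12}x_{ta}-a_{123}x_{ta}(1-x_{su})+b\,u,$$ $$f_2=a_{212}x_{rg}(1-x_{ta})-a_{22}x_{ta},$$ $$f_3=a_{313}x_{rg}(1-x_{su})+a_{323}x_{ta}(1-x_{su})-\big(a_{33c}x_{ta}+a_{33m}(1-x_{ta})\big)x_{su},$$ $$y_\lambda=g_1(p,x_{rg})=-c_{11}\ln(c_{12}x_{rg}),\qquad y_{sb}=g_2(p,x_{ta})=c_{20}-c_{21}x_{ta}.$$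 For $i\in\{\mathrm a,\mathrm b\}$, $y^i(t)$ is the output of $\Sigma(p^i)$ with initial condition $x_0^i$ and input $u^i$. Domains. With a constant $x_{rg,\max}$, the permissible codomains of $x(t)$, $u(t)$, $p$ and $y(t)$ are: $\mathbb D_{\mathrm x}=\{x\in\mathbb R^3_{\ge0}: x_{rg}\le x_{rg,\max},\,x_{ta}\le1,\,x_{su}\le1\}$; $\mathbb D_{\mathrm u}=\mathbb R_{\ge0}$; $\mathbb D_{\mathrm p}=\{p\in\mathbb R^{16}_{\ge0}: a_{12}\ge a_{123},\ a_{33m}\ge a_{33c},\ c_{12}x_{rg,\max}<1\}$; $\mathbb D_{\mathrm y}=\{y\in\mathbb R^2_{\ge0}: y=g(p,x),\ p\in\mathbb D_{\mathrm p},\ x\in\mathbb D_{\mathrm x}\}$. Writing $y_\lambda^{\mathrm{eq}}\in\mathbb D_{\mathrm y}$ for a scalar means that it is the first component of an element of $\mathbb D_{\mathrm y}$. Static characteristic. It is obtained by solving $0=f(p,x^{\mathrm{eq}},u^{\mathrm{eq}})$ and inverting the output function. Given $p$ and $y_\lambda^{\mathrm{eq}}$, put $x_{rg}^{\mathrm{eq}}=\frac1{c_{12}}e^{-y_\lambda^{\mathrm{eq}}/c_{11}}$, $$x_{ta}^{\mathrm{eq}}=\frac{a_{212}x_{rg}^{\mathrm{eq}}}{a_{212}x_{rg}^{\mathrm{eq}}+a_{22}},\qquad x_{su}^{\mathrm{eq}}=\frac{a_{313}x_{rg}^{\mathrm{eq}}+a_{323}x_{ta}^{\mathrm{eq}}}{a_{313}x_{rg}^{\mathrm{eq}}+a_{323}x_{ta}^{\mathrm{eq}}+a_{33c}x_{ta}^{\mathrm{eq}}+a_{33m}(1-x_{ta}^{\mathrm{eq}})},$$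 $$u^{\mathrm{eq}}=-\frac1b\Big(a_{12}x_{ta}^{\mathrm{eq}}-a_{123}x_{ta}^{\mathrm{eq}}(1-x_{su}^{\mathrm{eq}})+x_{rg}^{\mathrm{eq}}\big(-a_{11}+a_{112}(x_{ta}^{\mathrm{eq}}-1)+a_{113}(x_{su}^{\mathrm{eq}}-1)\big)\Big),$$ $y_{sb}^{\mathrm{eq}}=c_{20}-c_{21}x_{ta}^{\mathrm{eq}}$, and $\varphi(p,y_\lambda^{\mathrm{eq}})=(u^{\mathrm{eq}},x_{su}^{\mathrm{eq}},y_{sb}^{\mathrm{eq}})^\top$.
   Formalization: The u^eq-component of (2) is claimed only if at least one of the two equilibrium inputs is nonnegative (it can fail if both are negative and b^a<b^b); (1) and (2) are claimed where the logarithms and quotients in y and φ are defined. *)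

theory Defs
  imports "HOL-Analysis.Analysis"
begin

section \<open>Order relations given by sign vectors\<close>

text \<open>The entries of \<open>r\<close> are meant to be \<open>1\<close>, \<open>0\<close>, \<open>-1\<close>, standing for \<open>+\<close>, \<open>0\<close>, \<open>-\<close>.\<close>

definition sign_le :: "real^'n \<Rightarrow> real^'n \<Rightarrow> real^'n \<Rightarrow> bool"
    (\<open>(_ \<preceq>\<^bsub>_\<^esub> _)\<close> [51, 0, 51] 50) where
  "v \<preceq>\<^bsub>r\<^esub> w \<longleftrightarrow> (\<forall>i. r $ i * (v $ i - w $ i) \<le> 0)"

definition r_y :: "real^2" where "r_y = vector [-1, -1]"
definition r_x :: "real^3" where "r_x = vector [1, 1, 1]"
definition r_u :: "real^1" where "r_u = vector [1]"
definition r_p :: "real^16" where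
  "r_p = vector [-1, -1, -1, 1, -1, 1, -1, 1, 1, -1, -1, 1, -1, 1, -1, 1]"
definition r_phi :: "real^3" where "r_phi = vector [-1, 1, -1]"


section \<open>The model\<close>

text \<open>In the index type \<open>16\<close> the numeral \<open>16\<close> equals \<open>0\<close>; the indices \<open>1, \<dots>, 16\<close> are its 16 distinct
  elements, and \<^const>\<open>vector\<close> fills them in this order (likewise for \<open>2\<close> and \<open>3\<close>).\<close>

abbreviation a11  :: "real^16 \<Rightarrow> real" where "a11 p  \<equiv> p $ 1"
abbreviation a112 :: "real^16 \<Rightarrow> real" where "a112 p \<equiv> p $ 2"
abbreviation a113 :: "real^16 \<Rightarrow> real" where "a113 p \<equiv> p $ 3"
abbreviation a12  :: "real^16 \<Rightarrow> real" where "a12 p  \<equiv> p $ 4"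
abbreviation a123 :: "real^16 \<Rightarrow> real" where "a123 p \<equiv> p $ 5"
abbreviation a212 :: "real^16 \<Rightarrow> real" where "a212 p \<equiv> p $ 6"
abbreviation a22  :: "real^16 \<Rightarrow> real" where "a22 p  \<equiv> p $ 7"
abbreviation a313 :: "real^16 \<Rightarrow> real" where "a313 p \<equiv> p $ 8"
abbreviation a323 :: "real^16 \<Rightarrow> real" where "a323 p \<equiv> p $ 9"
abbreviation a33c :: "real^16 \<Rightarrow> real" where "a33c p \<equiv> p $ 10"
abbreviation a33m :: "real^16 \<Rightarrow> real" where "a33m p \<equiv> p $ 11"
abbreviation b_in :: "real^16 \<Rightarrow> real" where "b_in p \<equiv> p $ 12"
abbreviation c11  :: "real^16 \<Rightarrow> real" where "c11 p  \<equiv> p $ 13"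
abbreviation c12  :: "real^16 \<Rightarrow> real" where "c12 p  \<equiv> p $ 14"
abbreviation c20  :: "real^16 \<Rightarrow> real" where "c20 p  \<equiv> p $ 15"
abbreviation c21  :: "real^16 \<Rightarrow> real" where "c21 p  \<equiv> p $ 16"

abbreviation x_rg :: "real^3 \<Rightarrow> real" where "x_rg x \<equiv> x $ 1"
abbreviation x_ta :: "real^3 \<Rightarrow> real" where "x_ta x \<equiv> x $ 2"
abbreviation x_su :: "real^3 \<Rightarrow> real" where "x_su x \<equiv> x $ 3"

abbreviation y_lambda :: "real^2 \<Rightarrow> real" where "y_lambda y \<equiv> y $ 1"
abbreviation y_sb :: "real^2 \<Rightarrow> real" where "y_sb y \<equiv> y $ 2"

definition f :: "real^16 \<Rightarrow> real^3 \<Rightarrow> real \<Rightarrow> real^3" where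
  "f p x u = vector
    [x_rg x * (- a11 p + a112 p * (x_ta x - 1) + a113 p * (x_su x - 1))
       + a12 p * x_ta x - a123 p * x_ta x * (1 - x_su x) + b_in p * u,
     a212 p * x_rg x * (1 - x_ta x) - a22 p * x_ta x,
     a313 p * x_rg x * (1 - x_su x) + a323 p * x_ta x * (1 - x_su x)
       - (a33c p * x_ta x + a33m p * (1 - x_ta x)) * x_su x]"

definition g :: "real^16 \<Rightarrow> real^3 \<Rightarrow> real^2" where
  "g p x = vector [- c11 p * ln (c12 p * x_rg x), c20 p - c21 p * x_ta x]"

text \<open>The library totalises \<^const>\<open>ln\<close>; the output is a real vector only if the argument of the
  logarithm is positive, which the state domain (containing \<open>x_rg = 0\<close>) does not guarantee.\<close>

definition g_defined :: "real^16 \<Rightarrow> real^3 \<Rightarrow> bool" where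
  "g_defined p x \<longleftrightarrow> 0 < c12 p * x_rg x"


section \<open>Domains\<close>

definition D_x :: "real \<Rightarrow> (real^3) set" where
  "D_x xmax = {x. (\<forall>i. 0 \<le> x $ i) \<and> x_rg x \<le> xmax \<and> x_ta x \<le> 1 \<and> x_su x \<le> 1}"

definition D_u :: "real set" where
  "D_u = {0..}"

definition D_p :: "real \<Rightarrow> (real^16) set" where
  "D_p xmax = {p. (\<forall>i. 0 \<le> p $ i) \<and> a123 p \<le> a12 p \<and> a33c p \<le> a33m p \<and> c12 p * xmax < 1}"

definition D_y :: "real \<Rightarrow> (real^2) set" where
  "D_y xmax = {y. (\<forall>i. 0 \<le> y $ i) \<and>
     (\<exists>p \<in> D_p xmax. \<exists>x \<in> D_x xmax. g_defined p x \<and> y = g p x)}"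


section \<open>Trajectories\<close>

text \<open>State trajectories, with values in \<^const>\<open>D_x\<close>, of \<open>x' = f p x u\<close>, \<open>x 0 = x0\<close>, in the
  sense of Caratheodory: no regularity of the input is assumed, so the equation is required in
  integrated form. Classical solutions, and solutions for inputs with jumps, are covered by lemma
  \<open>trajectoryI\<close> below.\<close>

definition trajectory ::
    "real \<Rightarrow> real^16 \<Rightarrow> real^3 \<Rightarrow> (real \<Rightarrow> real) \<Rightarrow> (real \<Rightarrow> real^3) \<Rightarrow> bool" where
  "trajectory xmax p x0 u x \<longleftrightarrow> x 0 = x0 \<and>
     (\<forall>t\<ge>0. x t \<in> D_x xmax \<and> ((\<lambda>s. f p (x s) (u s)) has_integral (x t - x0)) {0..t})"

lemma trajectoryI:
  assumes "x 0 = x0" and "\<And>t. t \<ge> 0 \<Longrightarrow> x t \<in> D_x xmax"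
    and "continuous_on {0..} x" and "\<And>t. finite (S \<inter> {0..t})"
    and "\<And>t. t \<ge> 0 \<Longrightarrow> t \<notin> S \<Longrightarrow>
      (x has_vector_derivative f p (x t) (u t)) (at t within {0..})"
  shows "trajectory xmax p x0 u x"
  unfolding trajectory_def
proof (intro conjI allI impI)
  fix t :: real assume t: "0 \<le> t"
  have "((\<lambda>s. f p (x s) (u s)) has_integral (x t - x 0)) {0..t}"
  proof (rule fundamental_theorem_of_calculus_interior_strong[OF assms(4)[of t] t])
    show "continuous_on {0..t} x"
      using assms(3) by (rule continuous_on_subset) auto
    fix s assume s: "s \<in> {0<..<t} - S \<inter> {0..t}"
    then have "(x has_vector_derivative f p (x s) (u s)) (at s within {0..})"
      using assms(5)[of s] by auto
    then have "(x has_vector_derivative f p (x s) (u s)) (at s within {0<..<t})"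
      by (rule has_vector_derivative_within_subset) auto
    then show "(x has_vector_derivative f p (x s) (u s)) (at s)"
      using s by (simp add: at_within_open[of s "{0<..<t}"])
  qed
  then show "((\<lambda>s. f p (x s) (u s)) has_integral (x t - x0)) {0..t}"
    by (simp add: assms(1))
qed (use assms in auto)


section \<open>Static characteristic\<close>

definition x_rg_eq :: "real^16 \<Rightarrow> real \<Rightarrow> real" where
  "x_rg_eq p yl = 1 / c12 p * exp (- yl / c11 p)"

definition x_ta_eq :: "real^16 \<Rightarrow> real \<Rightarrow> real" where
  "x_ta_eq p yl = a212 p * x_rg_eq p yl / (a212 p * x_rg_eq p yl + a22 p)"

definition x_su_eq :: "real^16 \<Rightarrow> real \<Rightarrow> real" where
  "x_su_eq p yl = (a313 p * x_rg_eq p yl + a323 p * x_ta_eq p yl) /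
     (a313 p * x_rg_eq p yl + a323 p * x_ta_eq p yl
        + a33c p * x_ta_eq p yl + a33m p * (1 - x_ta_eq p yl))"

text \<open>The formula can be negative, in which case the equilibrium input lies outside \<^const>\<open>D_u\<close>.\<close>

definition u_eq :: "real^16 \<Rightarrow> real \<Rightarrow> real" where
  "u_eq p yl = - (1 / b_in p) *
     (a12 p * x_ta_eq p yl - a123 p * x_ta_eq p yl * (1 - x_su_eq p yl)
        + x_rg_eq p yl * (- a11 p + a112 p * (x_ta_eq p yl - 1) + a113 p * (x_su_eq p yl - 1)))"

definition y_sb_eq :: "real^16 \<Rightarrow> real \<Rightarrow> real" where
  "y_sb_eq p yl = c20 p - c21 p * x_ta_eq p yl"

definition phi :: "real^16 \<Rightarrow> real \<Rightarrow> real^3" where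
  "phi p yl = vector [u_eq p yl, x_su_eq p yl, y_sb_eq p yl]"

text \<open>All divisors occurring in \<^const>\<open>phi\<close> are nonzero; \<^const>\<open>D_p\<close> allows each to vanish.\<close>

definition phi_defined :: "real^16 \<Rightarrow> real \<Rightarrow> bool" where
  "phi_defined p yl \<longleftrightarrow> c11 p \<noteq> 0 \<and> c12 p \<noteq> 0 \<and> b_in p \<noteq> 0 \<and>
     a212 p * x_rg_eq p yl + a22 p \<noteq> 0 \<and>
     a313 p * x_rg_eq p yl + a323 p * x_ta_eq p yl
        + a33c p * x_ta_eq p yl + a33m p * (1 - x_ta_eq p yl) \<noteq> 0"

lemma phi_equilibrium:
  assumes "phi_defined p yl"
  defines "x \<equiv> vector [x_rg_eq p yl, x_ta_eq p yl, x_su_eq p yl]"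
  shows "f p x (u_eq p yl) = 0"
    and "0 < c12 p \<Longrightarrow> g p x = vector [yl, y_sb_eq p yl]"
proof -
  have "f p x (u_eq p yl) $ 1 = 0"
    using assms(1) by (simp add: x_def f_def u_eq_def phi_defined_def algebra_simps)
  moreover have "f p x (u_eq p yl) $ 2 = 0"
    using assms(1) by (simp add: x_def f_def x_ta_eq_def phi_defined_def field_simps)
  moreover have "f p x (u_eq p yl) $ 3 = 0"
  proof -
    define N where "N = a313 p * x_rg_eq p yl + a323 p * x_ta_eq p yl"
    define D where "D = a33c p * x_ta_eq p yl + a33m p * (1 - x_ta_eq p yl)"
    have "N + D \<noteq> 0" and "x_su_eq p yl = N / (N + D)"
      using assms(1) by (simp_all add: N_def D_def phi_defined_def x_su_eq_def add.assoc)
    moreover have "f p x (u_eq p yl) $ 3 = N * (1 - x_su_eq p yl) - D * x_su_eq p yl"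
      by (simp add: x_def f_def N_def D_def algebra_simps)
    ultimately show ?thesis
      by (simp add: field_simps)
  qed
  ultimately show "f p x (u_eq p yl) = 0"
    by (simp add: vec_eq_iff forall_3)
  show "g p x = vector [yl, y_sb_eq p yl]" if "0 < c12 p"
    using assms(1) that by (simp add: x_def g_def x_rg_eq_def y_sb_eq_def phi_defined_def)
qed

end

theory Submission
  imports Defs
begin

text \<open>On the state domain the vector field is monotone in the parameters and the input, and
  cooperative in the state. The difference \<open>w\<close> of two ordered trajectories therefore satisfies
  \<open>w i' \<le> L * max\<^sub>j w j\<close> wherever \<open>w i > 0\<close>, and starts nonpositive, so it stays nonpositive.
  Since the input is arbitrary, this comparison is carried out with integrals over intervals rather
  than with derivatives.
  For the static characteristic, every equilibrium quantity is a monotone function of the preceding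
  ones: \<open>x_ta\<close> and \<open>x_su\<close> have the form \<open>N / (N + D)\<close>, which increases in \<open>N\<close> and decreases in \<open>D\<close>,
  and the input is \<open>- H / b\<close> with \<open>H\<close> and \<open>b\<close> increasing, which decreases as long as it is
  nonnegative.\<close>

section \<open>Monotonicity of the vector field in parameters, input and state\<close>

lemma r_p_nth:
  "r_p $ 1 = -1" "r_p $ 2 = -1" "r_p $ 3 = -1" "r_p $ 4 = 1"
  "r_p $ 5 = -1" "r_p $ 6 = 1" "r_p $ 7 = -1" "r_p $ 8 = 1"
  "r_p $ 9 = 1" "r_p $ 10 = -1" "r_p $ 11 = -1" "r_p $ 12 = 1"
  "r_p $ 13 = -1" "r_p $ 14 = 1" "r_p $ 15 = -1" "r_p $ 16 = 1"
  by (simp_all add: r_p_def vector_def)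

lemma sign_le_r_pD:
  assumes "p \<preceq>\<^bsub>r_p\<^esub> q"
  shows "a11 q \<le> a11 p" "a112 q \<le> a112 p" "a113 q \<le> a113 p" "a12 p \<le> a12 q"
    "a123 q \<le> a123 p" "a212 p \<le> a212 q" "a22 q \<le> a22 p" "a313 p \<le> a313 q"
    "a323 p \<le> a323 q" "a33c q \<le> a33c p" "a33m q \<le> a33m p" "b_in p \<le> b_in q"
    "c20 q \<le> c20 p" "c21 p \<le> c21 q"
proof -
  have *: "r_p $ i * (p $ i - q $ i) \<le> 0" for i
    using assms by (simp add: sign_le_def)
  show "a11 q \<le> a11 p" using *[of 1] by (simp add: r_p_nth)
  show "a112 q \<le> a112 p" using *[of 2] by (simp add: r_p_nth)
  show "a113 q \<le> a113 p" using *[of 3] by (simp add: r_p_nth)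
  show "a12 p \<le> a12 q" using *[of 4] by (simp add: r_p_nth)
  show "a123 q \<le> a123 p" using *[of 5] by (simp add: r_p_nth)
  show "a212 p \<le> a212 q" using *[of 6] by (simp add: r_p_nth)
  show "a22 q \<le> a22 p" using *[of 7] by (simp add: r_p_nth)
  show "a313 p \<le> a313 q" using *[of 8] by (simp add: r_p_nth)
  show "a323 p \<le> a323 q" using *[of 9] by (simp add: r_p_nth)
  show "a33c q \<le> a33c p" using *[of 10] by (simp add: r_p_nth)
  show "a33m q \<le> a33m p" using *[of 11] by (simp add: r_p_nth)
  show "b_in p \<le> b_in q" using *[of 12] by (simp add: r_p_nth)
  show "c20 q \<le> c20 p" using *[of 15] by (simp add: r_p_nth)
  show "c21 p \<le> c21 q" using *[of 16] by (simp add: r_p_nth)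
qed

text \<open>On the state domain each parameter of \<open>f\<close> enters linearly with a
  coefficient of constant sign, the one recorded in \<open>r_p\<close>. For instance
  \<open>a112\<close> and \<open>a113\<close> multiply the nonpositive differences
  \<open>x_ta x - 1\<close> and \<open>x_su x - 1\<close>.\<close>

lemma f_mono_param:
  assumes "p \<preceq>\<^bsub>r_p\<^esub> q" "p \<in> D_p xmax" "q \<in> D_p xmax" "x \<in> D_x xmax" "0 \<le> u" "u \<le> v"
  shows "f p x u $ i \<le> f q x v $ i"
proof -
  note o = sign_le_r_pD[OF assms(1)]
  have x: "0 \<le> x_rg x" "0 \<le> x_ta x" "0 \<le> x_su x" "x_ta x \<le> 1" "x_su x \<le> 1"
    using assms(4) by (auto simp: D_x_def)
  have q: "0 \<le> q $ j" for j
    using assms(3) by (auto simp: D_p_def)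
  have bu: "b_in p * u \<le> b_in q * v"
    using o(12) assms(5,6) q by (intro mult_mono) auto
  have "x_rg x * (- a11 p + a112 p * (x_ta x - 1) + a113 p * (x_su x - 1))
      \<le> x_rg x * (- a11 q + a112 q * (x_ta x - 1) + a113 q * (x_su x - 1))"
    using o(1) mult_right_mono_neg[OF o(2), of "x_ta x - 1"]
      mult_right_mono_neg[OF o(3), of "x_su x - 1"] x
    by (intro mult_left_mono) auto
  moreover have "a12 p * x_ta x \<le> a12 q * x_ta x"
    using o x by (intro mult_right_mono) auto
  moreover have "a123 q * x_ta x * (1 - x_su x) \<le> a123 p * x_ta x * (1 - x_su x)"
    using o x by (intro mult_right_mono) auto
  ultimately have 1: "f p x u $ 1 \<le> f q x v $ 1"
    using bu by (simp add: f_def)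
  have "a212 p * x_rg x * (1 - x_ta x) \<le> a212 q * x_rg x * (1 - x_ta x)"
    "a22 q * x_ta x \<le> a22 p * x_ta x"
    using o x by (auto intro!: mult_right_mono)
  then have 2: "f p x u $ 2 \<le> f q x v $ 2"
    by (simp add: f_def)
  have "a313 p * x_rg x * (1 - x_su x) \<le> a313 q * x_rg x * (1 - x_su x)"
    "a323 p * x_ta x * (1 - x_su x) \<le> a323 q * x_ta x * (1 - x_su x)"
    "(a33c q * x_ta x + a33m q * (1 - x_ta x)) * x_su x
       \<le> (a33c p * x_ta x + a33m p * (1 - x_ta x)) * x_su x"
    using o x by (auto intro!: mult_right_mono add_mono)
  then have 3: "f p x u $ 3 \<le> f q x v $ 3"
    by (simp add: f_def)
  show ?thesis
    using 1 2 3 exhaust_3[of i] by auto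
qed

text \<open>The system is cooperative: expanding component \<open>i\<close> of the difference along \<open>x - z\<close>, the
  off-diagonal coefficients are nonnegative and bounded, and the diagonal coefficient is nonpositive,
  so that its term can be dropped where \<open>x $ i > z $ i\<close>.\<close>

lemma f_quasimono_bound:
  assumes p: "p \<in> D_p xmax" and x: "x \<in> D_x xmax" and z: "z \<in> D_x xmax"
    and i: "z $ i < x $ i" and M: "\<And>j. x $ j - z $ j \<le> M"
  shows "f p x u $ i - f p z u $ i
    \<le> (xmax * (a112 p + a113 p) + a12 p + a123 p + a212 p + a313 p + a323 p + a33m p) * M"
proof -
  have p0: "0 \<le> p $ j" and pc: "a123 p \<le> a12 p" "a33c p \<le> a33m p" for j
    using p by (auto simp: D_p_def)
  have x0: "0 \<le> x $ j" "x_ta x \<le> 1" "x_su x \<le> 1" for j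
    using x by (auto simp: D_x_def)
  have z0: "0 \<le> z $ j" "x_rg z \<le> xmax" "x_ta z \<le> 1" "x_su z \<le> 1" for j
    using z by (auto simp: D_x_def)
  have M0: "0 \<le> M" using i M[of i] by linarith
  have xmax0: "0 \<le> xmax" using z0(1)[of 1] z0(2) by linarith
  \<comment> \<open>A negative difference does no harm: it is first replaced by \<open>M\<close>,
    and then \<open>c\<close> can be enlarged to \<open>C\<close> because
    \<open>0 \<le> M\<close>.\<close>
  have bnd: "c * (x $ j - z $ j) \<le> C * M" if "0 \<le> c" "c \<le> C" for c C j
    using that M[of j] M0 by (meson mult_left_mono mult_right_mono order_trans)
  \<comment> \<open>These fill in the terms of the common constant that do not arise in the
    component at hand.\<close>
  have nn: "0 \<le> xmax * (a112 p + a113 p) * M" "0 \<le> p $ j * M" for j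
    using p0 M0 xmax0 by auto
  consider "i = 1" | "i = 2" | "i = 3" using exhaust_3 by blast
  then show ?thesis
  proof cases
    case 1
    have d: "(x$1 - z$1) * (- a11 p - a112 p * (1 - x$2) - a113 p * (1 - x$3)) \<le> 0"
    proof (rule mult_nonneg_nonpos)
      have "0 \<le> a112 p * (1 - x$2)" "0 \<le> a113 p * (1 - x$3)"
        using p0 x0 by auto
      then show "- a11 p - a112 p * (1 - x$2) - a113 p * (1 - x$3) \<le> 0"
        using p0[of 1] by linarith
    qed (use i 1 in auto)
    \<comment> \<open>The third coefficient is nonnegative because
      \<open>a123 p \<le> a12 p\<close>.\<close>
    have e: "(z$1 * a112 p) * (x$2 - z$2) \<le> (xmax * a112 p) * M"
      "(z$1 * a113 p) * (x$3 - z$3) \<le> (xmax * a113 p) * M"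
      "(a12 p - a123 p * (1 - x$3)) * (x$2 - z$2) \<le> a12 p * M"
      "(a123 p * z$2) * (x$3 - z$3) \<le> a123 p * M"
      using p0 pc z0 x0 mult_left_le[of "1 - x$3" "a123 p"]
      by (auto intro!: bnd mult_right_mono mult_left_le intro: order_trans)
    \<comment> \<open>Products are split by
      \<open>u * v - u' * v' = (u - u') * v + u' * (v - v')\<close>, hence coefficients with entries
      of both \<open>x\<close> and \<open>z\<close>.\<close>
    have "f p x u $ 1 - f p z u $ 1 =
      (x$1 - z$1) * (- a11 p - a112 p * (1 - x$2) - a113 p * (1 - x$3))
      + (z$1 * a112 p) * (x$2 - z$2) + (z$1 * a113 p) * (x$3 - z$3)
      + (a12 p - a123 p * (1 - x$3)) * (x$2 - z$2) + (a123 p * z$2) * (x$3 - z$3)"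
      by (simp add: f_def algebra_simps)
    with d e nn(2)[of 6] nn(2)[of 8] nn(2)[of 9] nn(2)[of 11] show ?thesis
      by (simp add: 1 algebra_simps)
  next
    case 2
    have e: "(a212 p * (1 - x$2)) * (x$1 - z$1) \<le> a212 p * M"
      using p0 x0 by (auto intro!: bnd mult_left_le)
    have "0 \<le> (a212 p * z$1 + a22 p) * (x$2 - z$2)"
      using p0 z0 i 2 by auto
    moreover have "f p x u $ 2 - f p z u $ 2 =
      (a212 p * (1 - x$2)) * (x$1 - z$1) - (a212 p * z$1 + a22 p) * (x$2 - z$2)"
      by (simp add: f_def algebra_simps)
    ultimately show ?thesis
      using e nn(1) nn(2)[of 4] nn(2)[of 5] nn(2)[of 8] nn(2)[of 9] nn(2)[of 11]
      by (simp add: 2 algebra_simps)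
  next
    case 3
    \<comment> \<open>Here \<open>a33c p \<le> a33m p\<close> enters: a larger \<open>x_ta\<close>
      lowers the decay rate of \<open>x_su\<close>.\<close>
    have e: "(a313 p * (1 - x$3)) * (x$1 - z$1) \<le> a313 p * M"
      "(a323 p * (1 - x$3)) * (x$2 - z$2) \<le> a323 p * M"
      "((a33m p - a33c p) * z$3) * (x$2 - z$2) \<le> a33m p * M"
      using p0 pc x0 z0 mult_left_le[of "z$3" "a33m p - a33c p"]
      by (auto intro!: bnd mult_left_le intro: order_trans)
    have "0 \<le> (a313 p * z$1 + a323 p * z$2 + a33c p * x$2 + a33m p * (1 - x$2)) * (x$3 - z$3)"
      using p0 z0 x0 i 3 by auto
    moreover have "f p x u $ 3 - f p z u $ 3 =
      (a313 p * (1 - x$3)) * (x$1 - z$1) + (a323 p * (1 - x$3)) * (x$2 - z$2)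
      + ((a33m p - a33c p) * z$3) * (x$2 - z$2)
      - (a313 p * z$1 + a323 p * z$2 + a33c p * x$2 + a33m p * (1 - x$2)) * (x$3 - z$3)"
      by (simp add: f_def algebra_simps)
    ultimately show ?thesis
      using e nn(1) nn(2)[of 4] nn(2)[of 5] nn(2)[of 6]
      by (simp add: 3 algebra_simps)
  qed
qed

section \<open>Comparison principle in integral form\<close>

text \<open>Let \<open>M\<close> be the largest value attained by any component. If \<open>M > 0\<close>, the component attaining it was
  nonpositive at some last time, from which it grew at rate at most \<open>L * M\<close>, hence by less than \<open>M\<close>.\<close>

lemma nonpos_step:
  fixes w F :: "'i::finite \<Rightarrow> real \<Rightarrow> real"
  assumes F: "\<And>i s t. \<lbrakk>a \<le> s; s \<le> t; t \<le> c\<rbrakk> \<Longrightarrow> (F i has_integral (w i t - w i s)) {s..t}"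
    and init: "\<And>i. w i a \<le> 0" and "0 \<le> L" and small: "L * (c - a) < 1" and "a \<le> c"
    and bound: "\<And>i t M. \<lbrakk>a \<le> t; t \<le> c; 0 < w i t; \<And>j. w j t \<le> M\<rbrakk> \<Longrightarrow> F i t \<le> L * M"
    and "t \<in> {a..c}"
  shows "w i t \<le> 0"
proof -
  have cont: "continuous_on {a..c} (w j)" for j
  proof -
    have "continuous_on {a..c} (\<lambda>t. w j a + integral {a..t} (F j))"
      using F[of a c j] \<open>a \<le> c\<close>
      by (intro continuous_intros indefinite_integral_continuous_1) (auto simp: integrable_on_def)
    moreover have "w j a + integral {a..t} (F j) = w j t" if "t \<in> {a..c}" for t
      using F[of a t j] that by (simp add: integral_unique)
    ultimately show ?thesis by (rule continuous_on_eq)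
  qed
  have "\<exists>s\<in>{a..c}. \<forall>t\<in>{a..c}. w j t \<le> w j s" for j
    using continuous_attains_sup[OF _ _ cont[of j]] \<open>a \<le> c\<close> by auto
  then obtain T where T: "\<And>j. T j \<in> {a..c}" "\<And>j t. t \<in> {a..c} \<Longrightarrow> w j t \<le> w j (T j)"
    by metis
  define M where "M = Max (range (\<lambda>j. w j (T j)))"
  have M: "w j t \<le> M" if "t \<in> {a..c}" for j t
    unfolding M_def using T(2)[OF that, of j] by (intro order_trans[OF _ Max_ge]) auto
  have "M \<in> range (\<lambda>j. w j (T j))"
    unfolding M_def by (intro Max_in) auto
  then obtain k where k: "M = w k (T k)" by auto
  have "M \<le> 0"
  proof (rule ccontr)
    assume "\<not> M \<le> 0"
    then have pos: "0 < M" by simp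
    define Z where "Z = {s \<in> {a..T k}. w k s \<le> 0}"
    have Tk: "a \<le> T k" "T k \<le> c" using T(1)[of k] by auto
    have "continuous_on {a..T k} (w k)"
      using Tk by (intro continuous_on_subset[OF cont]) auto
    then have "closed Z"
      unfolding Z_def by (rule continuous_on_closed_Collect_le) (rule continuous_on_const closed_atLeastAtMost)+
    then have "compact ({a..T k} \<inter> Z)"
      by (intro compact_Int_closed compact_Icc)
    then have "compact Z"
      by (rule back_subst) (auto simp: Z_def)
    moreover have "Z \<noteq> {}"
      unfolding Z_def using init[of k] Tk by auto
    ultimately obtain s where s: "s \<in> Z" "\<And>r. r \<in> Z \<Longrightarrow> r \<le> s"
      using compact_attains_sup by metis
    have s': "a \<le> s" "s \<le> T k" "w k s \<le> 0" using s(1) by (auto simp: Z_def)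
    have F_le: "F k r \<le> L * M" if "r \<in> {s..T k}" "r \<noteq> s" for r
    proof (rule bound)
      have "r \<notin> Z" using s(2)[of r] that by auto
      then show "0 < w k r" using that s' by (auto simp: Z_def)
    qed (use that s' Tk M in auto)
    \<comment> \<open>The rate bound is available only where \<open>w k\<close> is positive, which
      fails at \<open>s\<close>; changing the integrand at this one point leaves the integral
      unchanged.\<close>
    define G where "G = (\<lambda>r. if r = s then L * M else F k r)"
    have "(G has_integral (w k (T k) - w k s)) {s..T k}"
      by (rule has_integral_spike_finite[OF _ _ F[of s "T k" k], where S = "{s}"])
        (use s' Tk in \<open>auto simp: G_def\<close>)
    moreover have "((\<lambda>r. L * M) has_integral L * M * (T k - s)) {s..T k}"
      using has_integral_const_real[of "L * M" s "T k"] s' by (simp add: mult.commute)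
    ultimately have "w k (T k) - w k s \<le> L * M * (T k - s)"
      by (rule has_integral_le) (auto simp: G_def F_le)
    also have "\<dots> \<le> L * M * (c - a)"
      using \<open>0 \<le> L\<close> pos s' Tk by (intro mult_left_mono) auto
    also have "\<dots> = L * (c - a) * M" by simp
    also have "\<dots> < 1 * M"
      using small pos by (intro mult_strict_right_mono) auto
    finally show False using k s'(3) by simp
  qed
  then show ?thesis using M[OF \<open>t \<in> {a..c}\<close>, of i] by simp
qed

text \<open>The admissible step length depends on \<open>L\<close> alone, so induction over
  consecutive intervals of equal length reaches every time.\<close>

lemma nonpos_comparison:
  fixes w F :: "'i::finite \<Rightarrow> real \<Rightarrow> real"
  assumes F: "\<And>i t. 0 \<le> t \<Longrightarrow> (F i has_integral (w i t - w i 0)) {0..t}"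
    and init: "\<And>i. w i 0 \<le> 0" and "0 \<le> L"
    and bound: "\<And>i t M. \<lbrakk>0 \<le> t; 0 < w i t; \<And>j. w j t \<le> M\<rbrakk> \<Longrightarrow> F i t \<le> L * M"
    and "0 \<le> t"
  shows "w i t \<le> 0"
proof -
  \<comment> \<open>Additivity and uniqueness of the integral carry the equation over from intervals
    starting at 0.\<close>
  have F': "(F i has_integral (w i t - w i s)) {s..t}" if "0 \<le> s" "s \<le> t" for i s t
  proof -
    have "F i integrable_on {s..t}"
      by (rule integrable_subinterval_real[OF has_integral_integrable[OF F[of t i]]]) (use that in auto)
    then obtain y where y: "(F i has_integral y) {s..t}"
      unfolding integrable_on_def by blast
    have "(F i has_integral (w i s - w i 0 + y)) {0..t}"
      using that by (intro has_integral_combine[OF _ _ F[of s i] y]) simp_all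
    then have "y = w i t - w i s"
      using has_integral_unique[OF _ F[of t i]] that by fastforce
    then show ?thesis using y by simp
  qed
  \<comment> \<open>The summand 1 gives \<open>L * h < 1\<close> and also covers
    \<open>L = 0\<close>.\<close>
  define h where "h = 1 / (L + 1)"
  have h: "0 < h" "L * h < 1"
    using \<open>0 \<le> L\<close> by (auto simp: h_def divide_simps)
  have "\<forall>t\<in>{0..real n * h}. \<forall>i. w i t \<le> 0" for n
  proof (induction n)
    case 0
    then show ?case using init by simp
  next
    case (Suc n)
    show ?case
    proof (intro ballI allI)
      fix t i assume t: "t \<in> {0..real (Suc n) * h}"
      show "w i t \<le> 0"
      proof (cases "t \<le> real n * h")
        case True
        then show ?thesis using Suc t by auto
      next
        case False
        let ?a = "real n * h" and ?c = "real (Suc n) * h"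
        have a: "0 \<le> ?a" and ac: "?c - ?a = h" using h by (auto simp: algebra_simps)
        show ?thesis
        proof (rule nonpos_step[of ?a ?c F w L])
          show "w j ?a \<le> 0" for j using Suc a by auto
          show "(F j has_integral (w j r - w j s)) {s..r}" if "?a \<le> s" "s \<le> r" "r \<le> ?c" for j s r
            using F' that a by auto
          show "F j r \<le> L * M" if "?a \<le> r" "0 < w j r" "\<And>k. w k r \<le> M" for j r M
            using bound[of r j M] that a by auto
          show "t \<in> {?a..?c}" using False t by auto
        qed (use h ac \<open>0 \<le> L\<close> in auto)
      qed
    qed
  qed
  moreover obtain n :: nat where "t / h \<le> real n" using real_arch_simple by blast
  ultimately show ?thesis using \<open>0 \<le> t\<close> h by (auto simp: field_simps)
qed

section \<open>Monotonicity of trajectories and outputs\<close>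

lemma trajectory_mono:
  assumes p: "p \<in> D_p xmax" "q \<in> D_p xmax" "p \<preceq>\<^bsub>r_p\<^esub> q"
    and u: "\<And>t. 0 \<le> t \<Longrightarrow> 0 \<le> u t" "\<And>t. 0 \<le> t \<Longrightarrow> u t \<le> v t"
    and x0: "\<And>i. x0 $ i \<le> z0 $ i"
    and x: "trajectory xmax p x0 u x" and z: "trajectory xmax q z0 v z" and "0 \<le> t"
  shows "x t $ i \<le> z t $ i"
proof -
  have D: "x t \<in> D_x xmax" "z t \<in> D_x xmax" if "0 \<le> t" for t
    using x z that by (auto simp: trajectory_def)
  have init: "x 0 = x0" "z 0 = z0"
    using x z by (auto simp: trajectory_def)
  define L where "L = xmax * (a112 q + a113 q) + a12 q + a123 q + a212 q + a313 q + a323 q + a33m q"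
  have q0: "0 \<le> q $ j" for j using p by (auto simp: D_p_def)
  have "0 \<le> xmax" using D(1)[of 0] by (auto simp: D_x_def intro: order_trans)
  then have "0 \<le> L" unfolding L_def using q0 by (intro add_nonneg_nonneg mult_nonneg_nonneg)
  have "x t $ i - z t $ i \<le> 0"
  proof (rule nonpos_comparison[where w = "\<lambda>i t. x t $ i - z t $ i" and L = L
        and F = "\<lambda>i t. f p (x t) (u t) $ i - f q (z t) (v t) $ i"])
    fix i and t :: real assume t: "0 \<le> t"
    have "((\<lambda>s. f p (x s) (u s)) has_integral (x t - x 0)) {0..t}"
      "((\<lambda>s. f q (z s) (v s)) has_integral (z t - z 0)) {0..t}"
      using x z t by (auto simp: trajectory_def)
    from has_integral_diff[OF this(1,2)[THEN has_integral_linear, OF bounded_linear_vec_nth[of i]]]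
    show "((\<lambda>t. f p (x t) (u t) $ i - f q (z t) (v t) $ i) has_integral
        (x t $ i - z t $ i - (x 0 $ i - z 0 $ i))) {0..t}"
      by (simp add: o_def algebra_simps)
  next
    fix i t M
    assume t: "0 \<le> t" "0 < x t $ i - z t $ i" "\<And>j. x t $ j - z t $ j \<le> M"
    \<comment> \<open>The intermediate term \<open>f q (x t) (v t)\<close> separates the change of
      parameters and input from the change of state, so \<open>L\<close> is built from
      \<open>q\<close>.\<close>
    have "f p (x t) (u t) $ i \<le> f q (x t) (v t) $ i"
      using f_mono_param[OF p(3,1,2) D(1)] u t by auto
    moreover have "f q (x t) (v t) $ i - f q (z t) (v t) $ i \<le> L * M"
      unfolding L_def using f_quasimono_bound[OF p(2) D] t by auto
    ultimately show "f p (x t) (u t) $ i - f q (z t) (v t) $ i \<le> L * M" by linarith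
  qed (use x0 init \<open>0 \<le> L\<close> \<open>0 \<le> t\<close> in auto)
  then show ?thesis by simp
qed

text \<open>With \<open>c11\<close> and \<open>c12\<close> common to both systems, the logarithm
  only has to be compared in \<open>x_rg\<close>; positivity of its argument passes from
  \<open>x\<close> to the larger \<open>z\<close>.\<close>

lemma g_antimono:
  assumes p: "p \<in> D_p xmax" "p \<preceq>\<^bsub>r_p\<^esub> q" "c11 p = c11 q" "c12 p = c12 q"
    and x: "x \<in> D_x xmax" "\<And>i. x $ i \<le> z $ i" and "q \<in> D_p xmax" "g_defined p x"
  shows "g p x \<preceq>\<^bsub>r_y\<^esub> g q z"
proof -
  note o = sign_le_r_pD[OF p(2)]
  have 0: "0 \<le> p $ i" "0 \<le> q $ i" "0 \<le> x $ j" for i j using assms by (auto simp: D_p_def D_x_def)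
  have "0 < c12 p * x_rg x" using assms by (auto simp: g_defined_def)
  moreover have "c12 p * x_rg x \<le> c12 q * x_rg z"
    using x(2)[of 1] 0 p by (auto intro: mult_left_mono)
  ultimately have "c11 p * ln (c12 p * x_rg x) \<le> c11 q * ln (c12 q * x_rg z)"
    using 0 p(3) by (auto intro!: mult_left_mono)
  moreover have "c21 p * x_ta x \<le> c21 q * x_ta z"
    using 0 o x(2) by (intro mult_mono)
  ultimately show ?thesis
    using o by (simp add: sign_le_def forall_2 r_y_def g_def)
qed

section \<open>Monotonicity of the static characteristic\<close>

text \<open>Both denominators are positive; clearing them and cancelling \<open>N * N'\<close>
  leaves \<open>N * D' \<le> N' * D\<close>.\<close>

lemma quotient_mono:
  fixes N N' D D' :: real
  assumes "0 \<le> N" "N \<le> N'" "0 \<le> D'" "D' \<le> D" "N + D \<noteq> 0" "N' + D' \<noteq> 0"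
  shows "N / (N + D) \<le> N' / (N' + D')"
proof -
  have "N * D' \<le> N' * D" using assms by (intro mult_mono) auto
  moreover have "0 < N + D" "0 < N' + D'" using assms by auto
  ultimately show ?thesis by (simp add: field_simps)
qed

lemma quotient_in_unit:
  fixes N D :: real
  assumes "0 \<le> N" "0 \<le> D"
  shows "0 \<le> N / (N + D)" "N / (N + D) \<le> 1"
  using assms by (auto simp: divide_le_eq_1)

lemma phi_mono:
  assumes p: "p \<in> D_p xmax" and q: "q \<in> D_p xmax" and pq: "p \<preceq>\<^bsub>r_p\<^esub> q"
    and c: "c11 p = c11 q" "c12 p = c12 q"
    and def: "phi_defined p yl" "phi_defined q yl"
  shows "x_su_eq p yl \<le> x_su_eq q yl" "y_sb_eq q yl \<le> y_sb_eq p yl"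
    and "u_eq p yl \<in> D_u \<or> u_eq q yl \<in> D_u \<Longrightarrow> u_eq q yl \<le> u_eq p yl"
proof -
  note o = sign_le_r_pD[OF pq]
  have p0: "0 \<le> p $ i" and q0: "0 \<le> q $ i" for i
    using p q by (auto simp: D_p_def)
  have pc: "a123 p \<le> a12 p" "a33c p \<le> a33m p" and qc: "a123 q \<le> a12 q" "a33c q \<le> a33m q"
    using p q by (auto simp: D_p_def)
  define r where "r = x_rg_eq p yl"
  have r: "x_rg_eq p yl = r" "x_rg_eq q yl = r" using c by (auto simp: r_def x_rg_eq_def)
  have r0: "0 \<le> r" using p0 by (auto simp: r_def x_rg_eq_def)
  define t t' where "t = x_ta_eq p yl" and "t' = x_ta_eq q yl"
  define s s' where "s = x_su_eq p yl" and "s' = x_su_eq q yl"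
  note rts = r t_def[symmetric] t'_def[symmetric] s_def[symmetric] s'_def[symmetric]
  have t: "0 \<le> t" "t \<le> 1" "0 \<le> t'" "t' \<le> 1"
    unfolding t_def t'_def x_ta_eq_def r
    using quotient_in_unit p0 q0 r0 by (metis mult_nonneg_nonneg)+
  have tt: "t \<le> t'"
    unfolding t_def t'_def x_ta_eq_def r
    using def p0 q0 r0 o by (intro quotient_mono mult_right_mono mult_nonneg_nonneg) (auto simp: phi_defined_def r)
  define N N' where "N = a313 p * r + a323 p * t" and "N' = a313 q * r + a323 q * t'"
  define D D' where "D = a33c p * t + a33m p * (1 - t)" and "D' = a33c q * t' + a33m q * (1 - t')"
  have s_eq: "s = N / (N + D)" "s' = N' / (N' + D')"
    by (simp_all add: s_def s'_def x_su_eq_def rts N_def N'_def D_def D'_def add.assoc)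
  have nz: "N + D \<noteq> 0" "N' + D' \<noteq> 0"
    using def by (simp_all add: phi_defined_def rts N_def N'_def D_def D'_def add.assoc)
  have N: "0 \<le> N" "N \<le> N'" "0 \<le> N'"
    unfolding N_def N'_def using p0 q0 o r0 t tt
    by (auto intro!: add_nonneg_nonneg add_mono mult_mono mult_nonneg_nonneg)
  \<comment> \<open>First \<open>t'\<close> is lowered to \<open>t\<close>, which raises the value
    since \<open>a33c q \<le> a33m q\<close>; then the parameters of \<open>q\<close> are exchanged
    for those of \<open>p\<close>.\<close>
  have "D' = a33m q - (a33m q - a33c q) * t'" by (simp add: D'_def algebra_simps)
  also have "\<dots> \<le> a33m q - (a33m q - a33c q) * t"
    using qc tt by (simp add: mult_left_mono)
  also have "\<dots> = a33c q * t + a33m q * (1 - t)" by (simp add: algebra_simps)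
  also have "\<dots> \<le> D"
    unfolding D_def using o t by (intro add_mono mult_right_mono) auto
  finally have D: "D' \<le> D" .
  have D0: "0 \<le> D'" "0 \<le> D" unfolding D'_def D_def using p0 q0 t by auto
  have ss: "s \<le> s'"
    unfolding s_eq using N D D0 nz by (intro quotient_mono)
  then show "x_su_eq p yl \<le> x_su_eq q yl" by (simp add: rts)
  have s01: "0 \<le> s" "s \<le> 1" "0 \<le> s'" "s' \<le> 1"
    unfolding s_eq using quotient_in_unit N D0 by auto
  have "c21 p * t \<le> c21 q * t'" using o q0 t tt by (intro mult_mono)
  then show "y_sb_eq q yl \<le> y_sb_eq p yl"
    using o by (simp add: y_sb_eq_def rts)

  \<comment> \<open>\<open>H\<close> is the first component of \<open>f\<close> at the equilibrium
    state without the input term, so equilibrium means \<open>b * u = - H\<close>.\<close>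
  define H where "H = a12 p * t - a123 p * t * (1 - s)
    + r * (- a11 p + a112 p * (t - 1) + a113 p * (s - 1))"
  define H' where "H' = a12 q * t' - a123 q * t' * (1 - s')
    + r * (- a11 q + a112 q * (t' - 1) + a113 q * (s' - 1))"
  have u: "u_eq p yl = - H / b_in p" "u_eq q yl = - H' / b_in q"
    by (simp_all only: u_eq_def rts H_def H'_def mult_minus_left mult_1 divide_inverse)
      simp_all
  have b: "0 < b_in p" "0 < b_in q"
    using def p0[of 12] q0[of 12] by (auto simp: phi_defined_def less_le)
  have "H \<le> H'"
  proof -
    \<comment> \<open>Factoring out \<open>t\<close> gives a product of two increasing factors; the
      bracket for \<open>q\<close> is nonnegative because \<open>a123 q \<le> a12 q\<close>.\<close>
    have "a12 p * t - a123 p * t * (1 - s) = (a12 p - a123 p * (1 - s)) * t"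
      by (simp add: algebra_simps)
    also have "\<dots> \<le> (a12 q - a123 q * (1 - s')) * t'"
    proof (rule mult_mono)
      show "a12 p - a123 p * (1 - s) \<le> a12 q - a123 q * (1 - s')"
        using o q0 p0 s01 ss by (intro diff_mono mult_mono) auto
      show "0 \<le> a12 q - a123 q * (1 - s')"
        using mult_left_le[of "1 - s'" "a123 q"] qc q0 s01 by (auto intro: order_trans)
    qed (use t tt in auto)
    also have "\<dots> = a12 q * t' - a123 q * t' * (1 - s')"
      by (simp add: algebra_simps)
    finally have "a12 p * t - a123 p * t * (1 - s) \<le> a12 q * t' - a123 q * t' * (1 - s')" .
    moreover have "a112 q * (1 - t') \<le> a112 p * (1 - t)" "a113 q * (1 - s') \<le> a113 p * (1 - s)"
      using o p0 t tt s01 ss by (auto intro!: mult_mono)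
    then have "r * (- a11 p + a112 p * (t - 1) + a113 p * (s - 1))
      \<le> r * (- a11 q + a112 q * (t' - 1) + a113 q * (s' - 1))"
      using o r0 by (intro mult_left_mono) (auto simp: algebra_simps)
    ultimately show ?thesis unfolding H_def H'_def by linarith
  qed
  show "u_eq q yl \<le> u_eq p yl" if "u_eq p yl \<in> D_u \<or> u_eq q yl \<in> D_u"
  proof (cases "0 \<le> u_eq q yl")
    case True
    then have "0 \<le> - H'" unfolding u zero_le_divide_iff using b by linarith
    then show ?thesis unfolding u
      using \<open>H \<le> H'\<close> b o by (intro frac_le) auto
  next
    \<comment> \<open>A negative input for \<open>q\<close> forces the one for \<open>p\<close> to
      be nonnegative, hence larger.\<close>
    case False
    then show ?thesis using that by (auto simp: D_u_def)
  qed
qed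

text \<open>For positive \<open>H\<close> the value \<open>- H / b\<close> can increase with
  \<open>b\<close>, so the input components are compared only if one of them is admissible. The sign
  vector with first entry 0 states the order of the other two components without that
  condition.\<close>

theorem theorem1:
  fixes xmax :: real
    and pa pb :: "real^16"
    and x0a x0b :: "real^3"
    and ua ub :: "real \<Rightarrow> real"
  assumes "pa \<in> D_p xmax" and "pb \<in> D_p xmax"
    and "c11 pa = c11 pb" and "c12 pa = c12 pb"
    and "x0a \<in> D_x xmax" and "x0b \<in> D_x xmax"
    and "\<forall>t\<ge>0. ua t \<in> D_u" and "\<forall>t\<ge>0. ub t \<in> D_u"
    and "pa \<preceq>\<^bsub>r_p\<^esub> pb"
    and "x0a \<preceq>\<^bsub>r_x\<^esub> x0b"
    and "\<forall>t\<ge>0. vector [ua t] \<preceq>\<^bsub>r_u\<^esub> vector [ub t]"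
  shows "(\<forall>xa xb. trajectory xmax pa x0a ua xa \<and> trajectory xmax pb x0b ub xb \<longrightarrow>
            (\<forall>t\<ge>0. g_defined pa (xa t) \<and> g_defined pb (xb t) \<longrightarrow>
               g pa (xa t) \<preceq>\<^bsub>r_y\<^esub> g pb (xb t)))
       \<and> (\<forall>yl \<in> y_lambda ` D_y xmax. phi_defined pa yl \<and> phi_defined pb yl \<longrightarrow>
            (u_eq pa yl \<in> D_u \<or> u_eq pb yl \<in> D_u \<longrightarrow> phi pa yl \<preceq>\<^bsub>r_phi\<^esub> phi pb yl)
          \<and> phi pa yl \<preceq>\<^bsub>vector [0, 1, -1]\<^esub> phi pb yl)"
proof (intro conjI allI ballI impI)
  fix xa xb and t :: real
  assume tr: "trajectory xmax pa x0a ua xa \<and> trajectory xmax pb x0b ub xb"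
    and t: "0 \<le> t" and d: "g_defined pa (xa t) \<and> g_defined pb (xb t)"
  have u: "0 \<le> ua t" "ua t \<le> ub t" if "0 \<le> t" for t
    using assms(7,11) that by (auto simp: D_u_def sign_le_def r_u_def forall_1)
  have "x0a $ i \<le> x0b $ i" for i
    using assms(10) exhaust_3[of i] by (auto simp: sign_le_def r_x_def forall_3)
  then have "xa t $ i \<le> xb t $ i" for i
    using trajectory_mono[OF assms(1,2,9), of ua ub x0a x0b xa xb t] u tr t by blast
  moreover have "xa t \<in> D_x xmax"
    using tr t by (auto simp: trajectory_def)
  ultimately show "g pa (xa t) \<preceq>\<^bsub>r_y\<^esub> g pb (xb t)"
    using g_antimono[OF assms(1,9,3,4)] assms(2) d by blast
next
  fix yl assume "phi_defined pa yl \<and> phi_defined pb yl"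
  then have d: "phi_defined pa yl" "phi_defined pb yl" by auto
  note m = phi_mono[OF assms(1,2,9,3,4) d]
  show "phi pa yl \<preceq>\<^bsub>vector [0, 1, -1]\<^esub> phi pb yl"
    using m(1,2) by (simp add: sign_le_def phi_def forall_3)
  show "phi pa yl \<preceq>\<^bsub>r_phi\<^esub> phi pb yl" if "u_eq pa yl \<in> D_u \<or> u_eq pb yl \<in> D_u"
    using m(1,2) m(3)[OF that] by (simp add: sign_le_def phi_def r_phi_def forall_3)
qed

end
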